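(* Let $d\ge2$. The Euler monoid $(\mathrm{EM}_d,\boxplus)$ consists of all integer points in the pointed polyhedral cone $$\mathrm{CEM}_d:=\{x\in\mathrm{E}_d: x\ge f(\Delta_d)\},$$ which has the combinatorics of a cone over a product of two simplices $\Delta_{\lceil d/2\rceil-1}\times\Delta_{\lfloor d/2\rfloor-1}$. The minimal set of generators of the monoid (the reduced Hilbert basis of the cone) is given by the vectors $f(\Delta_d)+e_i+e_j$ with $i,j\in\{0,1,\dots,d-1\}$, where $i$ is even and $j$ is odd.
   Context: Coordinates of $\mathbb{R}^d$ are indexed by $0,\dots,d-1$, with standard basis vectors $e_0,\dots,e_{d-1}$. $\Delta_k$ denotes the $k$-simplex. The vector $f(\Delta_d)=\big(\binom{d+1}{1},\binom{d+1}{2},\dots,\binom{d+1}{d}\big)\in\mathbb{Z}^d$ is the vector of face numbers of the $d$-simplex, i.e. $f_i(\Delta_d)=\binom{d+1}{i+1}$. The Euler hyperplane is $\mathrm{E}_d=\{(x_0,\dots,x_{d-1})\in\mathbb{R}^d: x_0-x_1+\dots+(-1)^{d-1}x_{d-1}=1-(-1)^d\}$. Inequalities between vectors are componentwise. The Euler monoid is the set $\mathrm{EM}_d:=\{x\in\mathrm{E}_d:x\ge f(\Delta_d)\}\cap\mathbb{Z}^d$ with the operation $x\boxplus y:=x+y-f(\Delta_d)$, whose neutral element is $f(\Delta_d)$. The cone $\mathrm{CEM}_d$ has apex $f(\Delta_d)$. "Having the combinatorics of a cone over a polytope $B$" means that the face lattice of its nonempty faces is isomorphic to the face lattice of $B$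 (apex corresponding to the empty face, extremal rays to vertices of $B$, and so on). "Minimal set of generators" means the inclusion-minimal subset generating the monoid (with respect to $\boxplus$). *)

theory Defs
  imports "HOL-Analysis.Analysis" "HOL-Algebra.Group"
begin

text \<open>
  The space of real \<open>d\<close>-vectors with coordinates numbered \<open>0, \<dots>, d - 1\<close> is \<open>real ^ 'n\<close>
  together with a numbering \<open>ix\<close> of the index type, i.e. a bijection from \<open>UNIV :: 'n set\<close>
  onto \<open>{..<d}\<close>. The coordinate numbered \<open>k\<close> of \<open>x\<close> is \<open>x $ i\<close> for the \<open>i\<close> with \<open>ix i = k\<close>.
  The order on \<open>real ^ 'n\<close> is the componentwise one.
\<close>

definition f_simplex :: "nat \<Rightarrow> ('n::finite \<Rightarrow> nat) \<Rightarrow> real ^ 'n" where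
  "f_simplex d ix = (\<chi> i. real ((d + 1) choose (ix i + 1)))"

definition euler_hyperplane :: "nat \<Rightarrow> ('n::finite \<Rightarrow> nat) \<Rightarrow> (real ^ 'n) set" where
  "euler_hyperplane d ix = {x. (\<Sum>i\<in>UNIV. (- 1) ^ ix i * x $ i) = 1 - (- 1) ^ d}"

definition integer_points :: "(real ^ 'n::finite) set" where
  "integer_points = {x. \<forall>i. x $ i \<in> \<int>}"

definition CEM :: "nat \<Rightarrow> ('n::finite \<Rightarrow> nat) \<Rightarrow> (real ^ 'n) set" where
  "CEM d ix = {x \<in> euler_hyperplane d ix. f_simplex d ix \<le> x}"

definition euler_monoid :: "nat \<Rightarrow> ('n::finite \<Rightarrow> nat) \<Rightarrow> (real ^ 'n) monoid" where
  "euler_monoid d ix =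
    \<lparr> carrier = {x \<in> euler_hyperplane d ix. f_simplex d ix \<le> x} \<inter> integer_points,
      monoid.mult = (\<lambda>x y. x + y - f_simplex d ix),
      one = f_simplex d ix \<rparr>"

text \<open>The third conjunct says that the only linear subspace of the translated cone is zero.\<close>

definition pointed_polyhedral_cone :: "'a::euclidean_space \<Rightarrow> 'a set \<Rightarrow> bool" where
  "pointed_polyhedral_cone a C \<longleftrightarrow>
    polyhedron C \<and> convex_cone ((\<lambda>x. x - a) ` C) \<and>
    (\<forall>v. a + v \<in> C \<and> a - v \<in> C \<longrightarrow> v = 0)"

text \<open>
  Faces are ordered by inclusion, and an order isomorphism of lattices is a lattice
  isomorphism. As \<open>aff_dim {} = - 1\<close>, the dimension condition makes explicit that the apex
  corresponds to the empty face, extremal rays to vertices, and so on.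
\<close>

definition has_combinatorics_of_cone_over ::
    "'a::euclidean_space set \<Rightarrow> 'b::euclidean_space set \<Rightarrow> bool" where
  "has_combinatorics_of_cone_over C B \<longleftrightarrow>
    (\<exists>\<phi>. bij_betw \<phi> {F. F face_of C \<and> F \<noteq> {}} {G. G face_of B} \<and>
      (\<forall>F F'. F face_of C \<and> F \<noteq> {} \<and> F' face_of C \<and> F' \<noteq> {} \<longrightarrow>
        (F \<subseteq> F' \<longleftrightarrow> \<phi> F \<subseteq> \<phi> F')) \<and>
      (\<forall>F. F face_of C \<and> F \<noteq> {} \<longrightarrow> aff_dim F = aff_dim (\<phi> F) + 1))"

definition generates_monoid :: "('a, 'm) monoid_scheme \<Rightarrow> 'a set \<Rightarrow> bool" where
  "generates_monoid M A \<longleftrightarrow>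
    A \<subseteq> carrier M \<and> (\<forall>N. submonoid N M \<and> A \<subseteq> N \<longrightarrow> N = carrier M)"

definition minimal_generating_set :: "('a, 'm) monoid_scheme \<Rightarrow> 'a set \<Rightarrow> bool" where
  "minimal_generating_set M A \<longleftrightarrow>
    generates_monoid M A \<and> (\<forall>A'. A' \<subset> A \<longrightarrow> \<not> generates_monoid M A')"

text \<open>
  The reduced Hilbert basis of a cone \<open>C\<close> with apex \<open>a\<close> is the minimal set of generators of
  the monoid of its integer points, where \<open>a\<close> takes the role of the origin.
\<close>

definition cone_monoid :: "real ^ 'n::finite \<Rightarrow> (real ^ 'n) set \<Rightarrow> (real ^ 'n) monoid" where
  "cone_monoid a C =
    \<lparr> carrier = C \<inter> integer_points, monoid.mult = (\<lambda>x y. x + y - a), one = a \<rparr>"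

definition reduced_hilbert_basis :: "real ^ 'n::finite \<Rightarrow> (real ^ 'n) set \<Rightarrow> (real ^ 'n) set \<Rightarrow> bool"
  where "reduced_hilbert_basis a C H \<longleftrightarrow> minimal_generating_set (cone_monoid a C) H"

definition euler_generators :: "nat \<Rightarrow> ('n::finite \<Rightarrow> nat) \<Rightarrow> (real ^ 'n) set" where
  "euler_generators d ix =
    {f_simplex d ix + axis i 1 + axis j 1 | i j. even (ix i) \<and> odd (ix j)}"

end

theory Submission
  imports Defs
begin

text \<open>Write \<open>y = x - f(\<Delta>\<^sub>d)\<close>. As \<open>f(\<Delta>\<^sub>d)\<close> lies on the Euler hyperplane, the cone is the set of
  \<open>y \<ge> 0\<close> whose even-indexed and odd-indexed coordinates have the same sum. Subtracting
  \<open>e\<^sub>i + e\<^sub>j\<close> for a positive even coordinate \<open>i\<close> and a positive odd coordinate \<open>j\<close> lowers this sum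
  by 1, so these vectors generate the monoid, and they are indecomposable as their sum is 1.
  The nonempty faces are cut out by the vanishing of coordinates, and correspond to the
  empty set or to pairs of a nonempty set of even and a nonempty set of odd indices; such pairs
  are the nonempty faces of a product of two simplices.\<close>

section \<open>Products and simplices: spans, affine dimensions, convex hulls\<close>

text \<open>As both sets contain 0, \<open>S \<times> T\<close> contains copies of \<open>S\<close>
  and of \<open>T\<close> on the two axes, and the spans of these copies add up to the product of
  the spans.\<close>

lemma span_Times_zero:
  fixes S :: "'a::real_vector set" and T :: "'b::real_vector set"
  assumes "0 \<in> S" "0 \<in> T"
  shows "span (S \<times> T) = span S \<times> span T"
proof
  show "span (S \<times> T) \<subseteq> span S \<times> span T"
    by (intro span_minimal subspace_Times subspace_span) (auto simp: span_base)
  have l1: "linear (\<lambda>x::'a. (x, 0::'b))" and l2: "linear (\<lambda>y::'b. (0::'a, y))"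
    by (auto intro!: linearI)
  show "span S \<times> span T \<subseteq> span (S \<times> T)"
  proof clarify
    fix x y assume x: "x \<in> span S" and y: "y \<in> span T"
    have "(x, 0::'b) \<in> span ((\<lambda>x. (x, 0)) ` S)"
      unfolding linear_span_image[OF l1] using x by blast
    then have 1: "(x, 0) \<in> span (S \<times> T)"
      by (rule rev_subsetD) (intro span_mono, use assms in auto)
    have "(0::'a, y) \<in> span ((\<lambda>x. (0, x)) ` T)"
      unfolding linear_span_image[OF l2] using y by blast
    then have 2: "(0, y) \<in> span (S \<times> T)"
      by (rule rev_subsetD) (intro span_mono, use assms in auto)
    show "(x, y) \<in> span (S \<times> T)"
      using span_add[OF 1 2] by simp
  qed
qed

text \<open>Moving a point of each factor to 0 turns affine dimension into linear dimension, which
  is additive on products of subspaces. Both factors are nonempty because the empty set has affine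
  dimension -1.\<close>

lemma aff_dim_Times:
  fixes S :: "'a::euclidean_space set" and T :: "'b::euclidean_space set"
  assumes "S \<noteq> {}" "T \<noteq> {}"
  shows "aff_dim (S \<times> T) = aff_dim S + aff_dim T"
proof -
  obtain a b where ab: "a \<in> S" "b \<in> T"
    using assms by blast
  let ?S = "(\<lambda>x. x - a) ` S" and ?T = "(\<lambda>x. x - b) ` T"
  have 0: "0 \<in> ?S" "0 \<in> ?T"
    using ab by force+
  have img: "(\<lambda>x. x - (a, b)) ` (S \<times> T) = ?S \<times> ?T"
    by (force simp: image_iff)
  have "aff_dim (S \<times> T) = int (dim (?S \<times> ?T))"
    using aff_dim_eq_dim_subtract[of "(a, b)" "S \<times> T"] ab img by (simp add: hull_inc)
  also have "dim (?S \<times> ?T) = dim (span ?S \<times> span ?T)"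
    by (metis span_Times_zero[OF 0] dim_span)
  also have "\<dots> = dim ?S + dim ?T"
    by (simp add: dim_Times)
  finally show ?thesis
    using aff_dim_eq_dim_subtract[of a S] aff_dim_eq_dim_subtract[of b T] ab
    by (simp add: hull_inc)
qed

text \<open>For \<open>v\<close> in \<open>A\<close> but not in \<open>B\<close>, affine
  independence makes the hulls of \<open>{v}\<close> and \<open>B\<close> disjoint. This reduces the
  order of the faces of a simplex to that of their vertex sets.\<close>

lemma convex_hull_subset_iff_affine_independent:
  fixes C :: "'a::euclidean_space set"
  assumes "\<not> affine_dependent C" "A \<subseteq> C" "B \<subseteq> C"
  shows "convex hull A \<subseteq> convex hull B \<longleftrightarrow> A \<subseteq> B"
proof
  assume sub: "convex hull A \<subseteq> convex hull B"
  show "A \<subseteq> B"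
  proof
    fix v assume v: "v \<in> A"
    show "v \<in> B"
    proof (rule ccontr)
      assume "v \<notin> B"
      have "\<not> affine_dependent ({v} \<union> B)"
        using affine_dependent_subset[of "{v} \<union> B" C] assms v by blast
      then have "convex hull {v} \<inter> convex hull B \<subseteq> convex hull ({v} \<inter> B)"
        by (rule convex_hull_Int_subset)
      moreover have "v \<in> convex hull B"
        using sub hull_inc[OF v] by (rule subsetD)
      ultimately show False
        using \<open>v \<notin> B\<close> by simp
    qed
  qed
qed (rule hull_mono)

lemma aff_dim_convex_hull_affine_independent:
  fixes V :: "'a::euclidean_space set"
  assumes "\<not> affine_dependent V" "B \<subseteq> V"
  shows "aff_dim (convex hull B) = int (card B) - 1"
proof -
  have "\<not> affine_dependent B"
    using affine_dependent_subset assms by blast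
  then show ?thesis
    using aff_dim_affine_independent[of B] by (simp add: aff_dim_convex_hull)
qed

section \<open>Indecomposable elements and minimal generating sets\<close>

lemma submonoid_carrier_minus:
  assumes "monoid M" "g \<noteq> \<one>\<^bsub>M\<^esub>"
    and irr: "\<And>x y. x \<in> carrier M \<Longrightarrow> y \<in> carrier M \<Longrightarrow> x \<otimes>\<^bsub>M\<^esub> y = g \<Longrightarrow> x = g \<or> y = g"
  shows "submonoid (carrier M - {g}) M"
proof (rule submonoid.intro)
  fix x y assume "x \<in> carrier M - {g}" "y \<in> carrier M - {g}"
  then show "x \<otimes>\<^bsub>M\<^esub> y \<in> carrier M - {g}"
    using irr[of x y] monoid.m_closed[OF assms(1), of x y] by auto
qed (use assms(2) monoid.one_closed[OF assms(1)] in auto)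

text \<open>Deleting an indecomposable \<open>g\<close> from the carrier leaves a proper submonoid,
  in which no generating set can lie. Hence \<open>G\<close> is part of every generating set, and as
  it generates, no other set is minimal.\<close>

lemma minimal_generating_set_eq_iff:
  assumes M: "monoid M" and gen: "generates_monoid M G" and one: "\<one>\<^bsub>M\<^esub> \<notin> G"
    and irr: "\<And>g x y. g \<in> G \<Longrightarrow> x \<in> carrier M \<Longrightarrow> y \<in> carrier M \<Longrightarrow>
      x \<otimes>\<^bsub>M\<^esub> y = g \<Longrightarrow> x = g \<or> y = g"
  shows "minimal_generating_set M A \<longleftrightarrow> A = G"
proof -
  have sub: "G \<subseteq> A" if A: "generates_monoid M A" for A
  proof
    fix g assume g: "g \<in> G"
    have "submonoid (carrier M - {g}) M"
      using submonoid_carrier_minus[OF M] irr[OF g] one g by metis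
    moreover have "carrier M - {g} \<noteq> carrier M"
      using gen g by (auto simp: generates_monoid_def)
    ultimately show "g \<in> A"
      using A unfolding generates_monoid_def by blast
  qed
  show ?thesis
    unfolding minimal_generating_set_def using sub gen by blast
qed

section \<open>Integrality, parity counts and rounding\<close>

lemma Ints_gt_imp_ge_add_1: "a \<in> \<int> \<Longrightarrow> b \<in> \<int> \<Longrightarrow> a < b \<Longrightarrow> a + 1 \<le> (b::real)"
  by (elim Ints_cases) simp

lemma card_even_lessThan: "card {k. k < d \<and> even k} = (d + 1) div 2" for d :: nat
proof (induction d)
  case (Suc d)
  have "{k. k < Suc d \<and> even k} = (if even d then insert d {k. k < d \<and> even k} else {k. k < d \<and> even k})"
    by (auto simp: less_Suc_eq)
  then show ?case
    using Suc by auto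
qed simp

lemma card_odd_lessThan: "card {k. k < d \<and> odd k} = d div 2" for d :: nat
proof (induction d)
  case (Suc d)
  have "{k. k < Suc d \<and> odd k} = (if odd d then insert d {k. k < d \<and> odd k} else {k. k < d \<and> odd k})"
    by (auto simp: less_Suc_eq)
  then show ?case
    using Suc by auto
qed simp

text \<open>For matching the first simplex with the even indices, which get the ceiling because the
  numbering starts at 0.\<close>

lemma ceiling_half_nat: "\<lceil>real d / 2\<rceil> = int ((d + 1) div 2)"
proof -
  have "\<lceil>real d / 2\<rceil> = (int d + 1) div 2"
    by linarith
  then show ?thesis
    by (simp add: zdiv_int)
qed

lemma floor_half_nat: "\<lfloor>real d / 2\<rfloor> = int (d div 2)"
  using floor_divide_of_nat_eq[of d 2] by simp

section \<open>The cone in coordinates relative to its apex\<close>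

locale euler_cone =
  fixes d :: nat and ix :: "'n::finite \<Rightarrow> nat"
  assumes bij_ix: "bij_betw ix UNIV {..<d}"
begin

abbreviation f :: "real ^ 'n" where "f \<equiv> f_simplex d ix"
abbreviation C :: "(real ^ 'n) set" where "C \<equiv> CEM d ix"
abbreviation ev :: "'n set" where "ev \<equiv> {i. even (ix i)}"
abbreviation od :: "'n set" where "od \<equiv> {i. odd (ix i)}"

text \<open>A linear functional of \<open>x - f\<close>, hence additive under the monoid operation.
  On the cone its values for \<open>ev\<close> and \<open>od\<close> agree; this common value serves
  as the degree of a monoid element.\<close>

definition excess :: "'n set \<Rightarrow> real ^ 'n \<Rightarrow> real" where
  "excess A x = (\<Sum>i\<in>A. x $ i - f $ i)"

text \<open>The normal vector of the Euler hyperplane, so that facts about sets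
  \<open>a \<bullet> x = b\<close> apply.\<close>

definition alternating :: "real ^ 'n" where
  "alternating = (\<chi> i. (- 1) ^ ix i)"

lemma card_ev: "card ev = (d + 1) div 2"
proof -
  have "ix ` ev = {k. k < d \<and> even k}"
  proof -
    have "ix ` ev = range ix \<inter> {k. even k}"
      by auto
    then show ?thesis
      using bij_ix by (auto simp: bij_betw_def)
  qed
  then show ?thesis
    using card_image[OF inj_on_subset[OF bij_betw_imp_inj_on[OF bij_ix] subset_UNIV], of ev]
    by (simp add: card_even_lessThan)
qed

lemma card_od: "card od = d div 2"
proof -
  have "ix ` od = {k. k < d \<and> odd k}"
  proof -
    have "ix ` od = range ix \<inter> {k. odd k}"
      by auto
    then show ?thesis
      using bij_ix by (auto simp: bij_betw_def)
  qed
  then show ?thesis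
    using card_image[OF inj_on_subset[OF bij_betw_imp_inj_on[OF bij_ix] subset_UNIV], of od]
    by (simp add: card_odd_lessThan)
qed

lemma f_int: "f $ i \<in> \<int>"
  by (simp add: f_simplex_def)

lemma euler_hyperplane_eq: "euler_hyperplane d ix = {x. alternating \<bullet> x = 1 - (- 1) ^ d}"
  by (simp add: euler_hyperplane_def alternating_def inner_vec_def)

text \<open>Row \<open>d + 1\<close> of Pascal's triangle has alternating sum 0. The vector
  \<open>f\<close> omits its two outer entries, which account for the right-hand side.\<close>

lemma alternating_f: "alternating \<bullet> f = 1 - (- 1) ^ d"
proof -
  let ?c = "\<lambda>k. real (Suc d choose k)"
  have "alternating \<bullet> f = (\<Sum>i\<in>UNIV. (- 1) ^ ix i * ?c (Suc (ix i)))"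
    by (simp add: alternating_def inner_vec_def f_simplex_def)
  also have "\<dots> = (\<Sum>k<d. (- 1) ^ k * ?c (Suc k))"
    by (rule sum.reindex_bij_betw[OF bij_ix, of "\<lambda>k. (- 1) ^ k * ?c (Suc k)"])
  finally have 1: "alternating \<bullet> f = (\<Sum>k<d. (- 1) ^ k * ?c (Suc k))" .
  have "0 = (\<Sum>k<Suc (Suc d). (- 1) ^ k * ?c k)"
    using choose_alternating_sum[of "Suc d", where 'a = real]
    by (simp only: lessThan_Suc_atMost)
  also have "\<dots> = 1 + (\<Sum>k<Suc d. (- 1) ^ Suc k * ?c (Suc k))"
    by (subst sum.lessThan_Suc_shift) simp
  also have "\<dots> = 1 - (\<Sum>k<d. (- 1) ^ k * ?c (Suc k)) - (- 1) ^ d"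
    by (simp add: sum_negf)
  finally show ?thesis
    using 1 by simp
qed

lemma alternating_diff_f: "alternating \<bullet> x - alternating \<bullet> f = excess ev x - excess od x"
proof -
  have "alternating \<bullet> x - alternating \<bullet> f = (\<Sum>i\<in>UNIV. (- 1) ^ ix i * (x $ i - f $ i))"
    by (simp add: alternating_def inner_vec_def right_diff_distrib sum_subtractf)
  also have "\<dots> = (\<Sum>i\<in>ev \<union> od. (- 1) ^ ix i * (x $ i - f $ i))"
    by (rule sum.cong) auto
  also have "\<dots> = (\<Sum>i\<in>ev. (- 1) ^ ix i * (x $ i - f $ i)) + (\<Sum>i\<in>od. (- 1) ^ ix i * (x $ i - f $ i))"
    by (rule sum.union_disjoint) auto
  also have "\<dots> = excess ev x + (\<Sum>i\<in>od. - (x $ i - f $ i))"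
    unfolding excess_def by (intro arg_cong2[where f = "(+)"] sum.cong) auto
  finally show ?thesis
    by (simp add: excess_def sum_negf del: minus_diff_eq)
qed

text \<open>As \<open>f\<close> satisfies the Euler equation, subtracting it makes the equation
  homogeneous in \<open>x - f\<close>. Most later arguments use the cone in this form.\<close>

lemma mem_C_iff: "x \<in> C \<longleftrightarrow> (\<forall>i. f $ i \<le> x $ i) \<and> excess ev x = excess od x"
  using alternating_diff_f[of x] alternating_f
  by (auto simp: CEM_def euler_hyperplane_eq less_eq_vec_def)

lemma C_ge: "x \<in> C \<Longrightarrow> f $ i \<le> x $ i"
  by (simp add: mem_C_iff)

lemma excess_f [simp]: "excess A f = 0"
  by (simp add: excess_def)

lemma f_in_C: "f \<in> C"
  by (simp add: mem_C_iff)

lemma excess_boxplus: "excess A (x + y - f) = excess A x + excess A y"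
  unfolding excess_def sum.distrib[symmetric] by (rule sum.cong) auto

lemma excess_axis: "excess A (f + axis i 1 + axis j 1) = of_bool (i \<in> A) + of_bool (j \<in> A)"
  by (simp add: excess_def axis_def sum.distrib)

lemma excess_nonneg: "x \<in> C \<Longrightarrow> 0 \<le> excess A x"
  unfolding excess_def by (intro sum_nonneg) (simp add: C_ge)

lemma excess_pos: "x \<in> C \<Longrightarrow> i \<in> A \<Longrightarrow> x $ i \<noteq> f $ i \<Longrightarrow> 0 < excess A x"
  unfolding excess_def by (intro sum_pos2[of _ i]) (auto simp: C_ge less_le)

lemma exists_excess_pos: "0 < excess A x \<Longrightarrow> \<exists>i\<in>A. f $ i < x $ i"
  unfolding excess_def by (rule ccontr) (use sum_nonpos[of A "\<lambda>i. x $ i - f $ i"] in force)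

lemma excess_Ints:
  assumes "x \<in> integer_points"
  shows "excess A x \<in> \<int>"
  unfolding excess_def using assms f_int
  by (intro Ints_sum Ints_diff) (auto simp: integer_points_def)

text \<open>A coordinate above \<open>f\<close> would make the excess of its parity class positive,
  but both excesses are 0.\<close>

lemma excess_zero_imp_eq: "x = f" if "x \<in> C" "excess ev x = 0"
proof -
  have "x $ i = f $ i" for i
  proof (cases "even (ix i)")
    case True
    then show ?thesis
      using excess_pos[of x i ev] that by auto
  next
    case False
    then show ?thesis
      using excess_pos[of x i od] that by (auto simp: mem_C_iff)
  qed
  then show ?thesis
    by (simp add: vec_eq_iff)
qed

section \<open>The pointed polyhedral cone\<close>

lemma excess_combination: "excess A (f + s *\<^sub>R (x - f) + t *\<^sub>R (y - f)) = s * excess A x + t * excess A y"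
  by (simp add: excess_def sum.distrib sum_distrib_left)

lemma pointed_C: "pointed_polyhedral_cone f C"
proof -
  have "C = {x. alternating \<bullet> x = 1 - (- 1) ^ d} \<inter> \<Inter>((\<lambda>i. {x. axis i 1 \<bullet> x \<ge> f $ i}) ` UNIV)"
    by (auto simp: CEM_def euler_hyperplane_eq less_eq_vec_def inner_axis')
  then have "polyhedron C"
    by (auto intro!: polyhedron_Int polyhedron_Inter polyhedron_hyperplane polyhedron_halfspace_ge)
  moreover have "convex_cone ((\<lambda>x. x - f) ` C)"
  proof -
    have shift: "(\<lambda>x. x - f) ` C = {v. f + v \<in> C}"
      by (force simp: image_iff algebra_simps)
    have lin: "f + (s *\<^sub>R u + t *\<^sub>R v) \<in> C" if "f + u \<in> C" "f + v \<in> C" "0 \<le> s" "0 \<le> t" for u v s t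
    proof -
      have "excess A (f + (s *\<^sub>R u + t *\<^sub>R v)) = s * excess A (f + u) + t * excess A (f + v)" for A
        using excess_combination[of A s "f + u" t "f + v"] by (simp add: add.assoc)
      then show ?thesis
        using that by (simp add: mem_C_iff)
    qed
    \<comment> \<open>Closure under addition is the case \<open>s = t = 1\<close>, closure under
      scaling the case \<open>v = 0\<close>, \<open>t = 0\<close>.\<close>
    show ?thesis
      unfolding convex_cone_iff shift using lin[of _ _ 1 1] lin[of _ 0 _ 0] f_in_C by simp
  qed
  moreover have "v = 0" if "f + v \<in> C" "f - v \<in> C" for v
  proof -
    have "v $ i = 0" for i
      using C_ge[OF that(1), of i] C_ge[OF that(2), of i] by simp
    then show ?thesis
      by (simp add: vec_eq_iff)
  qed
  ultimately show ?thesis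
    unfolding pointed_polyhedral_cone_def by blast
qed

section \<open>The monoid and its generators\<close>

text \<open>Makes the minimal generators of the Euler monoid and the reduced Hilbert basis of the
  cone one and the same question.\<close>

lemma euler_monoid_eq: "euler_monoid d ix = cone_monoid f C"
  by (simp add: euler_monoid_def cone_monoid_def CEM_def)

lemma carrier_cone_monoid: "carrier (cone_monoid f C) = C \<inter> integer_points"
  by (simp add: cone_monoid_def)

lemma comm_monoid_cone: "comm_monoid (cone_monoid f C)"
proof (rule comm_monoidI)
  fix x y assume "x \<in> carrier (cone_monoid f C)" "y \<in> carrier (cone_monoid f C)"
  then have xy: "x \<in> C" "y \<in> C" "x \<in> integer_points" "y \<in> integer_points"
    by (auto simp: carrier_cone_monoid)
  have "f $ i \<le> x $ i + y $ i - f $ i" for i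
    using C_ge[OF xy(1), of i] C_ge[OF xy(2), of i] by simp
  then have "x + y - f \<in> C"
    using xy by (simp add: mem_C_iff excess_boxplus)
  moreover have "x + y - f \<in> integer_points"
    using xy f_int by (auto simp: integer_points_def)
  ultimately show "x \<otimes>\<^bsub>cone_monoid f C\<^esub> y \<in> carrier (cone_monoid f C)"
    by (simp add: cone_monoid_def)
qed (use f_in_C f_int in \<open>auto simp: cone_monoid_def integer_points_def\<close>)

lemma generators_subset: "euler_generators d ix \<subseteq> C \<inter> integer_points"
proof -
  have "f + axis i 1 + axis j 1 \<in> C \<inter> integer_points" if "even (ix i)" "odd (ix j)" for i j
  proof -
    have "f + axis i 1 + axis j 1 \<in> C"
      using that unfolding mem_C_iff excess_axis by (auto simp: axis_def)
    then show ?thesis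
      using f_int by (auto simp: integer_points_def axis_def)
  qed
  then show ?thesis
    by (auto simp: euler_generators_def)
qed

lemma generates_generators: "generates_monoid (cone_monoid f C) (euler_generators d ix)"
proof -
  have "N = C \<inter> integer_points"
    if N: "submonoid N (cone_monoid f C)" and G: "euler_generators d ix \<subseteq> N" for N
  proof
    \<comment> \<open>Induction on the common excess of \<open>x\<close>; at 0 only the apex
      remains, which is the neutral element.\<close>
    have "x \<in> N" if "x \<in> C" "x \<in> integer_points" "excess ev x = real n" for x n
      using that
    proof (induction n arbitrary: x)
      case 0
      then show ?case
        using excess_zero_imp_eq[of x] submonoid.one_closed[OF N] by (simp add: cone_monoid_def)
    next
      case (Suc n)
      obtain i where i: "even (ix i)" "f $ i < x $ i"
        using exists_excess_pos[of ev x] Suc.prems by auto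
      obtain j where j: "odd (ix j)" "f $ j < x $ j"
        using exists_excess_pos[of od x] Suc.prems by (auto simp: mem_C_iff)
      \<comment> \<open>Being distinct, the two coordinates lose only 1 each on passing to
        \<open>y\<close>; integrality leaves room for that above \<open>f\<close>.\<close>
      have ij: "i \<noteq> j"
        using i j by auto
      have 1: "f $ i + 1 \<le> x $ i" "f $ j + 1 \<le> x $ j"
        using i j Suc.prems(2) f_int by (auto intro!: Ints_gt_imp_ge_add_1 simp: integer_points_def)
      define g where "g = f + axis i 1 + axis j 1"
      define y where "y = x - axis i 1 - axis j 1"
      have x: "x = y + g - f"
        by (simp add: y_def g_def)
      have g: "g \<in> euler_generators d ix"
        using i j by (auto simp: euler_generators_def g_def)
      have ex: "excess ev g = 1" "excess od g = 1"
        using i j by (simp_all add: g_def excess_axis)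
      have "f $ k \<le> y $ k" for k
        using C_ge[OF Suc.prems(1), of k] 1 ij by (auto simp: y_def axis_def)
      moreover have "excess ev y = real n" "excess od y = real n"
        using Suc.prems excess_boxplus[of ev y g] excess_boxplus[of od y g] ex
        unfolding x[symmetric] by (simp_all add: mem_C_iff)
      ultimately have "y \<in> C" "excess ev y = real n"
        by (simp_all add: mem_C_iff)
      moreover have "y \<in> integer_points"
        using Suc.prems(2) by (auto simp: integer_points_def y_def axis_def)
      ultimately have "y \<in> N"
        using Suc.IH by blast
      then have "y \<otimes>\<^bsub>cone_monoid f C\<^esub> g \<in> N"
        using submonoid.m_closed[OF N] g G by blast
      then show ?case
        by (simp add: x cone_monoid_def)
    qed
    \<comment> \<open>The excess of an integer point of the cone is a nonnegative integer, so the
      induction reaches the whole carrier.\<close>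
    moreover have "\<exists>n. excess ev x = real n" if "x \<in> C" "x \<in> integer_points" for x
      using excess_Ints[OF that(2), of ev] excess_nonneg[OF that(1), of ev]
      by (metis Ints_cases nonneg_int_cases of_int_0_le_iff of_int_of_nat_eq)
    ultimately show "C \<inter> integer_points \<subseteq> N"
      by blast
    show "N \<subseteq> C \<inter> integer_points"
      using submonoid.subset[OF N] by (simp add: carrier_cone_monoid)
  qed
  then show ?thesis
    unfolding generates_monoid_def carrier_cone_monoid using generators_subset by blast
qed

text \<open>Generators have excess 1, and the excess is additive with natural numbers as values on
  the carrier. So one of two factors of a generator has excess 0 and is the neutral element.\<close>

lemma minimal_generators:
  "minimal_generating_set (cone_monoid f C) A \<longleftrightarrow> A = euler_generators d ix"
proof (rule minimal_generating_set_eq_iff)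
  have ex: "excess ev g = 1" if "g \<in> euler_generators d ix" for g
    using that by (auto simp: euler_generators_def excess_axis)
  show "\<one>\<^bsub>cone_monoid f C\<^esub> \<notin> euler_generators d ix"
    using ex by (fastforce simp: cone_monoid_def)
  fix g x y assume g: "g \<in> euler_generators d ix"
    and xy: "x \<in> carrier (cone_monoid f C)" "y \<in> carrier (cone_monoid f C)"
    and eq: "x \<otimes>\<^bsub>cone_monoid f C\<^esub> y = g"
  have "x + y - f = g"
    using eq by (simp add: cone_monoid_def)
  then have sum: "excess ev x + excess ev y = 1"
    using ex[OF g] excess_boxplus[of ev x y] by simp
  have xC: "x \<in> C" "y \<in> C" "x \<in> integer_points"
    using xy by (auto simp: carrier_cone_monoid)
  have "excess ev x = 0 \<or> 0 + 1 \<le> excess ev x"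
    using Ints_gt_imp_ge_add_1[of 0 "excess ev x"] excess_Ints[OF xC(3)]
      excess_nonneg[OF xC(1), of ev] by fastforce
  then have "excess ev x = 0 \<or> excess ev y = 0"
    using sum excess_nonneg[OF xC(2), of ev] by linarith
  then have "x = f \<or> y = f"
    using excess_zero_imp_eq xC by blast
  then show "x = g \<or> y = g"
    using \<open>x + y - f = g\<close> by auto
qed (use comm_monoid_cone generates_generators in \<open>auto simp: comm_monoid_def\<close>)

section \<open>Nonempty faces as sets of coordinates\<close>

text \<open>A nonempty face of the cone is determined by the coordinates that are not constant on it.
  The sets of coordinates that occur are those meeting the even indices iff they meet the odd
  ones, since both kinds of coordinates have the same total excess.\<close>

definition supp :: "(real ^ 'n) set \<Rightarrow> 'n set" where
  "supp F = {i. \<exists>x\<in>F. x $ i \<noteq> f $ i}"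

definition face :: "'n set \<Rightarrow> (real ^ 'n) set" where
  "face K = {x \<in> C. \<forall>i. i \<notin> K \<longrightarrow> x $ i = f $ i}"

definition admissible :: "'n set \<Rightarrow> bool" where
  "admissible K \<longleftrightarrow> (K \<inter> ev = {} \<longleftrightarrow> K \<inter> od = {})"

lemma convex_C: "convex C"
  using pointed_C polyhedron_imp_convex by (auto simp: pointed_polyhedral_cone_def)

lemma face_mono: "K \<subseteq> L \<Longrightarrow> face K \<subseteq> face L"
  by (auto simp: face_def)

lemma supp_mono: "F \<subseteq> G \<Longrightarrow> supp F \<subseteq> supp G"
  by (auto simp: supp_def)

lemma admissible_supp: "F \<subseteq> C \<Longrightarrow> admissible (supp F)"
proof -
  have "\<exists>j\<in>od. x $ j \<noteq> f $ j" if "x \<in> C" "x $ i \<noteq> f $ i" "even (ix i)" for x i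
    using that excess_pos[of x i ev] exists_excess_pos[of od x] by (force simp: mem_C_iff)
  moreover have "\<exists>j\<in>ev. x $ j \<noteq> f $ j" if "x \<in> C" "x $ i \<noteq> f $ i" "odd (ix i)" for x i
    using that excess_pos[of x i od] exists_excess_pos[of ev x] by (force simp: mem_C_iff)
  ultimately show "F \<subseteq> C \<Longrightarrow> admissible (supp F)"
    unfolding admissible_def supp_def by blast
qed

text \<open>Supplies a point of the face at which no inequality indexed by \<open>K\<close> is
  tight, for recovering \<open>K\<close> from its face and for computing the dimension.\<close>

lemma admissible_witness:
  assumes "admissible K"
  shows "\<exists>x\<in>face K. \<forall>i\<in>K. f $ i < x $ i"
proof -
  \<comment> \<open>Each parity class that meets \<open>K\<close> gets total weight 1, spread evenly
    over its part of \<open>K\<close>; the other classes get 0. Admissibility makes both totals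
    equal.\<close>
  define w where "w i = (if i \<in> K then 1 / card (K \<inter> (if even (ix i) then ev else od)) else 0)" for i
  define x where "x = (\<chi> i. f $ i + w i)"
  have "excess ev x = (\<Sum>i\<in>ev. w i)" "excess od x = (\<Sum>i\<in>od. w i)"
    by (simp_all add: excess_def x_def)
  moreover have "(\<Sum>i\<in>ev. w i) = (\<Sum>i\<in>K \<inter> ev. 1 / card (K \<inter> ev))"
    unfolding w_def by (intro sum.mono_neutral_cong_right) auto
  moreover have "(\<Sum>i\<in>od. w i) = (\<Sum>i\<in>K \<inter> od. 1 / card (K \<inter> od))"
    unfolding w_def by (intro sum.mono_neutral_cong_right) auto
  ultimately have "excess ev x = excess od x"
    using assms by (auto simp: admissible_def)
  then have "x \<in> face K"
    by (auto simp: face_def mem_C_iff x_def w_def)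
  moreover have "f $ i < x $ i" if "i \<in> K" for i
    using that by (auto simp: x_def w_def card_gt_0_iff)
  ultimately show ?thesis
    by blast
qed

text \<open>With \<open>face_supp\<close> this makes \<open>supp\<close> and \<open>face\<close>
  inverse to each other between nonempty faces and admissible sets.\<close>

lemma supp_face:
  assumes "admissible K"
  shows "supp (face K) = K"
proof
  show "supp (face K) \<subseteq> K"
    by (auto simp: supp_def face_def)
  obtain x where x: "x \<in> face K" "\<forall>i\<in>K. f $ i < x $ i"
    using admissible_witness[OF assms] by blast
  show "K \<subseteq> supp (face K)"
  proof
    fix i assume "i \<in> K"
    then have "x $ i \<noteq> f $ i"
      using x(2) by force
    then show "i \<in> supp (face K)"
      using x(1) unfolding supp_def by blast
  qed
qed

text \<open>On the cone \<open>x $ i\<close> is bounded below by \<open>f $ i\<close>; if an inner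
  point of a segment attains this bound, so do both ends.\<close>

lemma face_of_face: "face K face_of C"
  unfolding face_of_def
proof (intro conjI ballI impI)
  show "face K \<subseteq> C"
    by (auto simp: face_def)
  have "face K = C \<inter> \<Inter>((\<lambda>i. {x. axis i 1 \<bullet> x = f $ i}) ` (- K))"
    by (auto simp: face_def inner_axis')
  then show "convex (face K)"
    by (auto intro!: convex_Int convex_C convex_INT convex_hyperplane)
next
  fix a b x assume a: "a \<in> C" and b: "b \<in> C" and x: "x \<in> face K" and seg: "x \<in> open_segment a b"
  obtain u where u: "0 < u" "u < 1" "x = (1 - u) *\<^sub>R a + u *\<^sub>R b"
    using seg by (auto simp: in_segment)
  have "a $ i = f $ i \<and> b $ i = f $ i" if "i \<notin> K" for i
  proof -
    have "(1 - u) * (a $ i - f $ i) + u * (b $ i - f $ i) = 0"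
      using x that u(3) by (simp add: face_def algebra_simps)
    moreover have "0 \<le> (1 - u) * (a $ i - f $ i)" "0 \<le> u * (b $ i - f $ i)"
      using u C_ge[OF a, of i] C_ge[OF b, of i] by simp_all
    ultimately have "(1 - u) * (a $ i - f $ i) = 0" "u * (b $ i - f $ i) = 0"
      by linarith+
    then show ?thesis
      using u by simp
  qed
  then show "a \<in> face K" "b \<in> face K"
    using a b by (auto simp: face_def)
qed

text \<open>A relative interior point \<open>x\<close> of \<open>F\<close> lies strictly above
  \<open>f\<close> on \<open>supp F\<close>. So a segment from any \<open>y\<close> in
  \<open>face (supp F)\<close> to \<open>x\<close> can be prolonged beyond \<open>x\<close> inside
  the cone, and the face property puts \<open>y\<close> into \<open>F\<close>.\<close>

lemma face_supp:
  assumes F: "F face_of C" and ne: "F \<noteq> {}"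
  shows "face (supp F) = F"
proof
  have FC: "F \<subseteq> C"
    using F face_of_imp_subset by blast
  show "F \<subseteq> face (supp F)"
    using FC by (auto simp: face_def supp_def)
  obtain x where xr: "x \<in> rel_interior F"
    using ne F by (meson ex_in_conv face_of_imp_convex rel_interior_eq_empty)
  then have xF: "x \<in> F"
    using rel_interior_subset by blast
  then have xC: "x \<in> C"
    using FC by blast
  have pos: "f $ i < x $ i" if i: "i \<in> supp F" for i
  proof (rule ccontr)
    assume "\<not> f $ i < x $ i"
    then have xi: "x $ i = f $ i"
      using C_ge[OF xC, of i] by simp
    obtain y where y: "y \<in> F" "y $ i \<noteq> f $ i"
      using i by (auto simp: supp_def)
    \<comment> \<open>Going from \<open>y\<close> through \<open>x\<close> and slightly beyond stays
      in \<open>F\<close>; as \<open>x $ i\<close> is already minimal, coordinate \<open>i\<close>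
      cannot have decreased on the way.\<close>
    obtain e where e: "e > 1" "(1 - e) *\<^sub>R y + e *\<^sub>R x \<in> F"
      using xr y convex_rel_interior_iff[of F x] F face_of_imp_convex by blast
    have "(e - 1) * (y $ i - f $ i) \<le> 0"
      using C_ge[of "(1 - e) *\<^sub>R y + e *\<^sub>R x" i] e FC xi by (auto simp: algebra_simps)
    then have "y $ i \<le> f $ i"
      using e by (simp add: mult_le_0_iff)
    then show False
      using y FC C_ge[of y i] by auto
  qed
  show "face (supp F) \<subseteq> F"
  proof
    fix y assume y: "y \<in> face (supp F)"
    show "y \<in> F"
    proof (cases "y = x")
      case False
      \<comment> \<open>On \<open>supp F\<close> there is slack at \<open>t = 0\<close> and
        continuity applies; elsewhere \<open>x\<close> and \<open>y\<close> both agree with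
        \<open>f\<close>. Finitely many coordinates then allow a common \<open>t\<close>.\<close>
      have "\<forall>\<^sub>F t in at_right 0. f $ i \<le> x $ i - t * (y $ i - x $ i)" for i
      proof (cases "i \<in> supp F")
        case True
        have "((\<lambda>t. x $ i - t * (y $ i - x $ i)) \<longlongrightarrow> x $ i - 0 * (y $ i - x $ i)) (at_right 0)"
          by (intro tendsto_intros)
        then have "\<forall>\<^sub>F t in at_right 0. f $ i < x $ i - t * (y $ i - x $ i)"
          using pos[OF True] by (intro order_tendstoD(1)) auto
        then show ?thesis
          by (rule eventually_mono) simp
      next
        case False
        then show ?thesis
          using y xF by (auto simp: face_def supp_def)
      qed
      then have "\<forall>\<^sub>F t in at_right 0. \<forall>i. f $ i \<le> x $ i - t * (y $ i - x $ i)"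
        by (rule eventually_all_finite)
      moreover have "\<forall>\<^sub>F t in at_right 0. (0::real) < t"
        by (rule eventually_at_right_less)
      ultimately have "\<forall>\<^sub>F t in at_right 0. (0::real) < t \<and> (\<forall>i. f $ i \<le> x $ i - t * (y $ i - x $ i))"
        by eventually_elim simp
      then obtain t :: real where t: "0 < t" "\<And>i. f $ i \<le> x $ i - t * (y $ i - x $ i)"
        using eventually_happens' trivial_limit_at_right_real by blast
      define z where "z = x - t *\<^sub>R (y - x)"
      have "excess A z = (1 + t) * excess A x - t * excess A y" for A
        by (simp add: excess_def z_def sum_distrib_left flip: sum_subtractf) (simp add: algebra_simps)
      then have "z \<in> C"
        using t xC y by (simp add: mem_C_iff face_def) (simp add: z_def)
      moreover have "x \<in> open_segment y z"
      proof -
        \<comment> \<open>Solving \<open>z = x - t *\<^sub>R (y - x)\<close> for \<open>x\<close>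
          gives weight \<open>1 / (1 + t)\<close> to \<open>z\<close>.\<close>
        define s where "s = 1 / (1 + t)"
        have s: "0 < s" "s < 1" "s * (1 + t) = 1"
          using t by (simp_all add: s_def)
        have "(1 - s) *\<^sub>R y + s *\<^sub>R z = (1 - s * (1 + t)) *\<^sub>R y + (s * (1 + t)) *\<^sub>R x"
          by (simp add: z_def algebra_simps)
        then have "x = (1 - s) *\<^sub>R y + s *\<^sub>R z"
          unfolding s(3) by simp
        moreover have "y \<noteq> z"
        proof
          assume "y = z"
          then have "(1 + t) *\<^sub>R (y - x) = 0"
            by (simp add: z_def algebra_simps)
          then show False
            using t False by simp
        qed
        ultimately show ?thesis
          unfolding in_segment using s by blast
      qed
      ultimately show ?thesis
        using face_ofD[OF F] xF y by (auto simp: face_def)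
    qed (use xF in simp)
  qed
qed

section \<open>Dimensions of the faces\<close>

text \<open>The coordinate flat \<open>A\<close> has dimension \<open>card K\<close>, the Euler
  hyperplane lowers it by 1, and the inequalities do not lower it further, as
  \<open>admissible_witness\<close> satisfies them strictly. At \<open>K = {}\<close> the flat is
  just the apex and lies in the hyperplane.\<close>

lemma aff_dim_face:
  assumes K: "admissible K" "K \<noteq> {}"
  shows "aff_dim (face K) = int (card K) - 1"
proof -
  define V where "V = {v::real ^ 'n. \<forall>i. i \<notin> K \<longrightarrow> v $ i = 0}"
  define A where "A = {x::real ^ 'n. \<forall>i. i \<notin> K \<longrightarrow> x $ i = f $ i}"
  define H where "H = {x. alternating \<bullet> x = 1 - (- 1) ^ d}"
  \<comment> \<open>Only inequalities from \<open>K\<close> enter: the others are equalities on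
    \<open>A\<close>, and with them the interior would miss \<open>A\<close>.\<close>
  define U where "U = {x::real ^ 'n. \<forall>i\<in>K. f $ i \<le> x $ i}"
  have V: "subspace V"
    by (auto simp: V_def subspace_def)
  have AV: "A = (+) f ` V"
  proof
    show "A \<subseteq> (+) f ` V"
    proof
      fix x assume "x \<in> A"
      then show "x \<in> (+) f ` V"
        by (intro image_eqI[of _ _ "x - f"]) (auto simp: A_def V_def)
    qed
  qed (auto simp: A_def V_def)
  have "aff_dim A = int (card K)"
    unfolding AV aff_dim_translation_eq aff_dim_subspace[OF V]
    unfolding V_def using dim_substandard_cart[of K, where 'a = real] by (simp add: dim_vec_eq)
  moreover have affA: "affine A"
    unfolding AV using V affine_translation[of V f] by (simp add: subspace_imp_affine)
  moreover have "f \<in> A \<inter> H"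
    by (simp add: A_def H_def alternating_f)
  \<comment> \<open>A unit step along a coordinate in \<open>K\<close> changes
    \<open>alternating \<bullet> x\<close> by 1 or -1.\<close>
  moreover have "\<not> A \<subseteq> H"
  proof -
    obtain i where i: "i \<in> K"
      using K by blast
    have "f + axis i 1 \<in> A"
      using i by (auto simp: A_def axis_def)
    moreover have "alternating $ i \<noteq> 0"
      by (simp add: alternating_def)
    then have "f + axis i 1 \<notin> H"
      by (simp add: H_def inner_right_distrib alternating_f inner_axis)
    ultimately show ?thesis
      by blast
  qed
  ultimately have dim: "aff_dim (A \<inter> H) = int (card K) - 1"
    using aff_dim_affine_Int_hyperplane[of A alternating "1 - (- 1) ^ d"] by (auto simp: H_def)
  have face: "face K = A \<inter> H \<inter> U"
  proof -
    have "f $ i \<le> x $ i" if "x \<in> A" "i \<notin> K" for x i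
      using that by (simp add: A_def)
    moreover have "face K = A \<inter> H \<inter> {x. \<forall>i. f $ i \<le> x $ i}"
      by (auto simp: face_def CEM_def A_def H_def euler_hyperplane_eq less_eq_vec_def)
    ultimately show ?thesis
      unfolding U_def by blast
  qed
  have "open {x::real ^ 'n. \<forall>i\<in>K. f $ i < x $ i}"
  proof -
    have "{x::real ^ 'n. \<forall>i\<in>K. f $ i < x $ i} = (\<Inter>i\<in>K. {x. f $ i < x $ i})"
      by auto
    then show ?thesis
      by (auto intro!: open_INT open_Collect_less continuous_intros)
  qed
  then have int: "{x::real ^ 'n. \<forall>i\<in>K. f $ i < x $ i} \<subseteq> interior U"
    by (intro interior_maximal) (auto simp: U_def less_imp_le)
  obtain x where x: "x \<in> face K" "\<forall>i\<in>K. f $ i < x $ i"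
    using admissible_witness[OF K(1)] by blast
  have "x \<in> A \<inter> H" "x \<in> interior U"
    using x(1) face int x(2) by auto
  then have "A \<inter> H \<inter> interior U \<noteq> {}"
    by blast
  moreover have "convex (A \<inter> H)"
    unfolding H_def by (intro convex_Int affine_imp_convex affA convex_hyperplane)
  ultimately show ?thesis
    unfolding face by (subst aff_dim_convex_Int_nonempty_interior) (use dim in auto)
qed

lemma face_empty: "face {} = {f}"
  using f_in_C by (auto simp: face_def vec_eq_iff)

section \<open>Comparison with the product of two simplices\<close>

text \<open>Even indices label the vertices of \<open>S\<close>, odd ones those of \<open>T\<close>,
  and \<open>W K\<close> is the product of the faces spanned by the labels in \<open>K\<close>.
  Admissibility lets only \<open>K = {}\<close> stand for the empty face, so \<open>W\<close> after
  \<open>supp\<close> is the isomorphism.\<close>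

lemma combinatorics:
  fixes S :: "'a::euclidean_space set" and T :: "'b::euclidean_space set"
  assumes S: "(\<lceil>real d / 2\<rceil> - 1) simplex S" and T: "(\<lfloor>real d / 2\<rfloor> - 1) simplex T"
  shows "has_combinatorics_of_cone_over C (S \<times> T)"
proof -
  obtain VS where VS: "\<not> affine_dependent VS" "card VS = card ev" "S = convex hull VS"
    using S unfolding simplex_def ceiling_half_nat card_ev by auto
  obtain VT where VT: "\<not> affine_dependent VT" "card VT = card od" "T = convex hull VT"
    using T unfolding simplex_def floor_half_nat card_od by auto
  obtain g where g: "bij_betw g ev VS"
    using VS aff_independent_finite by (metis finite finite_same_card_bij)
  obtain h where h: "bij_betw h od VT"
    using VT aff_independent_finite by (metis finite finite_same_card_bij)
  define W where "W K = (convex hull (g ` (K \<inter> ev))) \<times> (convex hull (h ` (K \<inter> od)))" for K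
  have subS: "g ` (K \<inter> ev) \<subseteq> VS" and subT: "h ` (K \<inter> od) \<subseteq> VT" for K
    using g h by (auto simp: bij_betw_def)
  have W_mono: "W K \<subseteq> W L \<longleftrightarrow> K \<subseteq> L" if "admissible K" for K L
  proof -
    \<comment> \<open>An empty factor makes \<open>W K\<close> empty; for admissible
      \<open>K\<close> this happens only if \<open>K\<close> is empty.\<close>
    have "W K \<subseteq> W L \<longleftrightarrow> K \<inter> ev = {} \<or> K \<inter> od = {} \<or>
        g ` (K \<inter> ev) \<subseteq> g ` (L \<inter> ev) \<and> h ` (K \<inter> od) \<subseteq> h ` (L \<inter> od)"
      unfolding W_def times_subset_iff
      by (simp add: convex_hull_subset_iff_affine_independent[OF VS(1) subS subS]
          convex_hull_subset_iff_affine_independent[OF VT(1) subT subT])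
    also have "g ` (K \<inter> ev) \<subseteq> g ` (L \<inter> ev) \<longleftrightarrow> K \<inter> ev \<subseteq> L \<inter> ev"
      using g by (intro inj_on_image_subset_iff[of g ev]) (auto simp: bij_betw_def)
    also have "h ` (K \<inter> od) \<subseteq> h ` (L \<inter> od) \<longleftrightarrow> K \<inter> od \<subseteq> L \<inter> od"
      using h by (intro inj_on_image_subset_iff[of h od]) (auto simp: bij_betw_def)
    finally show ?thesis
      using that unfolding admissible_def by blast
  qed
  have W_face: "W K face_of S \<times> T" for K
  proof -
    have "convex hull (g ` (K \<inter> ev)) face_of S" "convex hull (h ` (K \<inter> od)) face_of T"
      unfolding VS(3) VT(3) face_of_convex_hull_affine_independent[OF VS(1)]
        face_of_convex_hull_affine_independent[OF VT(1)] using subS subT by blast+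
    then show ?thesis
      unfolding W_def by (rule face_of_Times)
  qed
  have W_surj: "\<exists>K. admissible K \<and> W K = G" if G: "G face_of S \<times> T" for G
  proof (cases "G = {}")
    \<comment> \<open>Treated apart: a product decomposition of the empty face may have just one
      empty factor, which would give an inadmissible \<open>K\<close>.\<close>
    case True
    then show ?thesis
      by (intro exI[of _ "{}"]) (simp add: W_def admissible_def)
  next
    case False
    obtain F F' where FF': "F face_of S" "F' face_of T" "G = F \<times> F'"
      using G unfolding face_of_Times_decomp by blast
    obtain c1 where c1: "c1 \<subseteq> VS" "F = convex hull c1"
      using FF'(1) unfolding VS(3) face_of_convex_hull_affine_independent[OF VS(1)] by blast
    obtain c2 where c2: "c2 \<subseteq> VT" "F' = convex hull c2"
      using FF'(2) unfolding VT(3) face_of_convex_hull_affine_independent[OF VT(1)] by blast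
    define K where "K = {i \<in> ev. g i \<in> c1} \<union> {i \<in> od. h i \<in> c2}"
    have "K \<inter> ev = {i \<in> ev. g i \<in> c1}" "K \<inter> od = {i \<in> od. h i \<in> c2}"
      by (auto simp: K_def)
    then have im: "g ` (K \<inter> ev) = c1" "h ` (K \<inter> od) = c2"
      using c1(1) c2(1) bij_betw_imp_surj_on[OF g] bij_betw_imp_surj_on[OF h] by blast+
    have "c1 \<noteq> {}" "c2 \<noteq> {}"
      using False FF'(3) c1 c2 by auto
    then have "admissible K"
      using im by (auto simp: admissible_def)
    then show ?thesis
      using im FF'(3) c1 c2 by (auto simp: W_def)
  qed
  have dimW: "aff_dim (W K) + 1 = aff_dim (face K)" if K: "admissible K" for K
  proof (cases "K = {}")
    \<comment> \<open>The apex has dimension 0 and the empty face -1.\<close>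
    case True
    then show ?thesis
      by (simp add: W_def face_empty)
  next
    case False
    then have ne: "K \<inter> ev \<noteq> {}" "K \<inter> od \<noteq> {}"
      using K unfolding admissible_def by blast+
    have "card (g ` (K \<inter> ev)) = card (K \<inter> ev)" "card (h ` (K \<inter> od)) = card (K \<inter> od)"
      using g h by (auto intro!: card_image intro: inj_on_subset simp: bij_betw_def)
    moreover have "card K = card (K \<inter> ev) + card (K \<inter> od)"
      by (subst card_Un_disjoint[symmetric]) (auto intro!: arg_cong[where f = card])
    \<comment> \<open>With \<open>p\<close> even and \<open>q\<close> odd indices in
      \<open>K\<close>, the product has dimension \<open>(p - 1) + (q - 1)\<close> and the face of
      the cone \<open>p + q - 1\<close>.\<close>
    ultimately show ?thesis
      using ne unfolding W_def aff_dim_face[OF K False]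
      by (simp add: aff_dim_Times aff_dim_convex_hull_affine_independent[OF VS(1) subS] aff_dim_convex_hull_affine_independent[OF VT(1) subT])
  qed
  define \<phi> where "\<phi> F = W (supp F)" for F
  have adm: "admissible (supp F)" if "F face_of C" for F
    using that admissible_supp face_of_imp_subset by blast
  have supp_iff: "supp F \<subseteq> supp F' \<longleftrightarrow> F \<subseteq> F'"
    if "F face_of C" "F \<noteq> {}" "F' face_of C" "F' \<noteq> {}" for F F'
    using that face_supp face_mono supp_mono by metis
  have mono: "F \<subseteq> F' \<longleftrightarrow> \<phi> F \<subseteq> \<phi> F'"
    if "F face_of C" "F \<noteq> {}" "F' face_of C" "F' \<noteq> {}" for F F'
    unfolding \<phi>_def W_mono[OF adm[OF that(1)]] using supp_iff[OF that] by simp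
  have "bij_betw \<phi> {F. F face_of C \<and> F \<noteq> {}} {G. G face_of S \<times> T}"
  proof (rule bij_betw_imageI)
    show "inj_on \<phi> {F. F face_of C \<and> F \<noteq> {}}"
      by (intro inj_onI) (use mono in blast)
  next
    show "\<phi> ` {F. F face_of C \<and> F \<noteq> {}} = {G. G face_of S \<times> T}"
    proof (intro subset_antisym subsetI)
      fix G assume "G \<in> {G. G face_of S \<times> T}"
      then obtain K where K: "admissible K" "W K = G"
        using W_surj by blast
      have "f \<in> face K"
        using f_in_C by (simp add: face_def)
      then have "face K \<in> {F. F face_of C \<and> F \<noteq> {}}"
        using face_of_face by auto
      moreover have "\<phi> (face K) = G"
        using K by (simp add: \<phi>_def supp_face)
      ultimately show "G \<in> \<phi> ` {F. F face_of C \<and> F \<noteq> {}}"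
        by blast
    qed (auto simp: \<phi>_def W_face)
  qed
  moreover have "aff_dim F = aff_dim (\<phi> F) + 1" if "F face_of C" "F \<noteq> {}" for F
    using dimW[OF adm[OF that(1)]] face_supp[OF that] by (simp add: \<phi>_def)
  ultimately show ?thesis
    unfolding has_combinatorics_of_cone_over_def using mono by blast
qed

end

theorem proposition4p2:
  fixes d :: nat and ix :: "'n::finite \<Rightarrow> nat"
  assumes "d \<ge> 2"
    and "bij_betw ix UNIV {..<d}"
  shows "comm_monoid (euler_monoid d ix) \<and>
    carrier (euler_monoid d ix) = CEM d ix \<inter> integer_points \<and>
    pointed_polyhedral_cone (f_simplex d ix) (CEM d ix) \<and>
    (\<forall>(S :: 'a::euclidean_space set) (T :: 'b::euclidean_space set).
      (\<lceil>real d / 2\<rceil> - 1) simplex S \<and> (\<lfloor>real d / 2\<rfloor> - 1) simplex T \<longrightarrow>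
      has_combinatorics_of_cone_over (CEM d ix) (S \<times> T)) \<and>
    (\<forall>A. minimal_generating_set (euler_monoid d ix) A \<longleftrightarrow> A = euler_generators d ix) \<and>
    (\<forall>H. reduced_hilbert_basis (f_simplex d ix) (CEM d ix) H \<longleftrightarrow> H = euler_generators d ix)"
proof -
  interpret euler_cone d ix
    using assms by unfold_locales
  show ?thesis
    unfolding reduced_hilbert_basis_def euler_monoid_eq
    using comm_monoid_cone carrier_cone_monoid pointed_C combinatorics minimal_generators by blast
qed

end
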